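(* Let $q\ge 6$ be a prime power. A ruled quintic surface $\mathcal V$ of $\mathrm{PG}(6,q)$ contains exactly one non-degenerate conic (namely its conic directrix).
   Context: Construction: in $\mathrm{PG}(6,q)$ let $\alpha$ be a plane and $\Pi_3$ a $3$-space with $\alpha\cap\Pi_3=\emptyset$. Let $\mathcal C$ be a non-degenerate conic in $\alpha$ and $\mathcal N_3$ a twisted cubic in $\Pi_3$, parametrised as $\mathcal C=\{(1,\theta,\theta^2)\}$ and $\mathcal N_3=\{(1,\epsilon,\epsilon^2,\epsilon^3)\}$ ($\theta,\epsilon\in\mathbb F_q\cup\{\infty\}$), and let $\phi\in\mathrm{PGL}(2,q)$ act on parameters, giving a bijection $\mathcal C\to\mathcal N_3$. The ruled quintic surface $\mathcal V$ is the set of points on the $q+1$ lines (generators) joining each point of $\mathcal C$ to its image under $\phi$; $\mathcal C$ is its conic directrix. *)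

theory Defs
  imports "HOL-Analysis.Analysis"
begin

text \<open>
  The projective space over a finite field \<open>'a\<close> with homogeneous coordinate vectors in
  \<open>'a ^ 'n\<close> has projective dimension \<open>CARD('n) - 1\<close>; a point is a one-dimensional
  vector subspace, represented as its set of vectors, and \<open>'a ^ 7\<close> gives \<open>PG(6,q)\<close>
  with \<open>q = CARD('a)\<close>.  A projective subspace is represented by its underlying vector
  subspace; \<open>proj_points\<close> turns it into a set of points.
\<close>

definition proj_points :: "('a::field ^ 'n) set \<Rightarrow> ('a ^ 'n) set set" where
  "proj_points W = {vec.span {v} | v. v \<in> W \<and> v \<noteq> 0}"

definition proj_subspace :: "nat \<Rightarrow> ('a::field ^ 'n) set \<Rightarrow> bool" where
  "proj_subspace d W \<longleftrightarrow> vec.subspace W \<and> vec.dim W = d + 1"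

definition join_points :: "('a::field ^ 'n) set \<Rightarrow> ('a ^ 'n) set \<Rightarrow> ('a ^ 'n) set set" where
  "join_points P R = proj_points (vec.span (P \<union> R))"

definition polar_form :: "('a::field ^ 'n \<Rightarrow> 'a) \<Rightarrow> 'a ^ 'n \<Rightarrow> 'a ^ 'n \<Rightarrow> 'a" where
  "polar_form Q v w = Q (v + w) - Q v - Q w"

definition quadratic_form_on :: "('a::field ^ 'n) set \<Rightarrow> ('a ^ 'n \<Rightarrow> 'a) \<Rightarrow> bool" where
  "quadratic_form_on W Q \<longleftrightarrow>
     (\<forall>c. \<forall>v\<in>W. Q (c *s v) = c\<^sup>2 * Q v) \<and>
     (\<forall>u\<in>W. \<forall>v\<in>W. \<forall>w\<in>W. polar_form Q (u + v) w = polar_form Q u w + polar_form Q v w) \<and>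
     (\<forall>c. \<forall>v\<in>W. \<forall>w\<in>W. polar_form Q (c *s v) w = c * polar_form Q v w)"

text \<open>
  Non-degeneracy is the absence of singular points.  The condition \<open>Q v = 0\<close> matters in
  characteristic 2, where the polar form of a ternary quadratic form always has a nonzero radical.
\<close>

definition nondegenerate_on :: "('a::field ^ 'n) set \<Rightarrow> ('a ^ 'n \<Rightarrow> 'a) \<Rightarrow> bool" where
  "nondegenerate_on W Q \<longleftrightarrow>
     (\<forall>v\<in>W. Q v = 0 \<and> (\<forall>w\<in>W. polar_form Q v w = 0) \<longrightarrow> v = 0)"

definition nondegenerate_conic :: "('a::field ^ 'n) set set \<Rightarrow> bool" where
  "nondegenerate_conic D \<longleftrightarrow>
     (\<exists>W Q. proj_subspace 2 W \<and> quadratic_form_on W Q \<and> nondegenerate_on W Q \<and>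
            D = {P \<in> proj_points W. \<forall>v\<in>P. Q v = 0})"

definition coord_basis :: "nat \<Rightarrow> (nat \<Rightarrow> 'a::field ^ 'n) \<Rightarrow> ('a ^ 'n) set \<Rightarrow> bool" where
  "coord_basis d e W \<longleftrightarrow>
     inj_on e {..d} \<and> vec.independent (e ` {..d}) \<and> vec.span (e ` {..d}) = W"

text \<open>
  Parameters range over \<open>'a option\<close>, the field together with \<open>None\<close> for \<open>\<infinity>\<close>.
  Relative to the coordinate basis \<open>e 0, \<dots>, e d\<close>, the parameter \<open>t\<close> gives the point
  \<open>(1, t, \<dots>, t^d)\<close> and \<open>\<infinity>\<close> gives \<open>(0, \<dots>, 0, 1)\<close>; this is a conic for
  \<open>d = 2\<close> and a twisted cubic for \<open>d = 3\<close>.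
\<close>

definition curve_point :: "nat \<Rightarrow> (nat \<Rightarrow> 'a::field ^ 'n) \<Rightarrow> 'a option \<Rightarrow> ('a ^ 'n) set" where
  "curve_point d e \<theta> =
     vec.span {case \<theta> of None \<Rightarrow> e d | Some t \<Rightarrow> (\<Sum>i\<le>d. (t ^ i) *s e i)}"

definition moebius :: "'a::field \<Rightarrow> 'a \<Rightarrow> 'a \<Rightarrow> 'a \<Rightarrow> 'a option \<Rightarrow> 'a option" where
  "moebius a b c d \<theta> = (case \<theta> of
       None \<Rightarrow> (if c = 0 then None else Some (a / c))
     | Some t \<Rightarrow> (if c * t + d = 0 then None else Some ((a * t + b) / (c * t + d))))"

definition PGL2 :: "('a::field option \<Rightarrow> 'a option) set" where
  "PGL2 = {moebius a b c d | a b c d. a * d - b * c \<noteq> 0}"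

definition ruled_quintic_surface ::
    "('a::field ^ 7) set set \<Rightarrow> ('a ^ 7) set set \<Rightarrow> bool" where
  "ruled_quintic_surface V C \<longleftrightarrow>
     (\<exists>\<alpha> S e f \<phi>.
        proj_subspace 2 \<alpha> \<and> proj_subspace 3 S \<and> proj_points \<alpha> \<inter> proj_points S = {} \<and>
        coord_basis 2 e \<alpha> \<and> coord_basis 3 f S \<and> \<phi> \<in> PGL2 \<and>
        C = range (curve_point 2 e) \<and>
        V = (\<Union>\<theta>. join_points (curve_point 2 e \<theta>) (curve_point 3 f (\<phi> \<theta>))))"

end

theory Submission
  imports Defs
begin

text \<open>
  Over a finite field a non-degenerate ternary quadratic form has a zero, hence is equivalent to a
  multiple of \<open>y\<^sup>2 - x * z\<close>, and a non-degenerate conic \<open>D\<close> is parametrised by quadratic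
  polynomials. If \<open>D\<close> lies on the surface, then projecting it from the plane of the directrix onto
  the 3-space gives four quadratic polynomials satisfying the equations of the twisted cubic. These
  equations have degree 4 in the parameter, so with at least 5 field elements they hold identically,
  and a degree argument shows that the projection is a polynomial \<open>g\<close> times a fixed point of the
  cubic. If \<open>g\<close> were nonzero, at least three points of \<open>D\<close> would lie on one generator, but no three
  points of a conic are collinear. So \<open>g = 0\<close> and \<open>D\<close> lies in the plane of the directrix, which
  meets the surface only in the directrix; both have one point for each parameter, so they coincide.
\<close>

section \<open>Coordinates\<close>

definition curve_vec :: "nat \<Rightarrow> (nat \<Rightarrow> 'a::field ^ 'n) \<Rightarrow> 'a option \<Rightarrow> 'a ^ 'n" where
  "curve_vec d e \<theta> = (case \<theta> of None \<Rightarrow> e d | Some t \<Rightarrow> (\<Sum>i\<le>d. (t ^ i) *s e i))"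

text \<open>Treats infinity as one more coordinate vector, so that coefficients of two curve points
  can be compared by one formula instead of by cases on the parameter.\<close>

definition curve_coord :: "nat \<Rightarrow> 'a::field option \<Rightarrow> nat \<Rightarrow> 'a" where
  "curve_coord d \<theta> i = (case \<theta> of None \<Rightarrow> (if i = d then 1 else 0) | Some t \<Rightarrow> t ^ i)"

lemma curve_point_eq_span: "curve_point d e \<theta> = vec.span {curve_vec d e \<theta>}"
  by (simp add: curve_point_def curve_vec_def)

lemma coord_basis_mem_iff:
  assumes "coord_basis d e W"
  shows "v \<in> W \<longleftrightarrow> (\<exists>c. v = (\<Sum>i\<le>d. c i *s e i))"
proof
  have inj: "inj_on e {..d}" and W: "W = vec.span (e ` {..d})"
    using assms by (auto simp: coord_basis_def)
  assume "v \<in> W"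
  then obtain u where "v = (\<Sum>x\<in>e ` {..d}. u x *s x)"
    unfolding W by (subst (asm) vec.span_finite) auto
  also have "\<dots> = (\<Sum>i\<le>d. u (e i) *s e i)"
    using inj by (simp add: sum.reindex)
  finally show "\<exists>c. v = (\<Sum>i\<le>d. c i *s e i)" by (rule exI[of _ "\<lambda>i. u (e i)"])
next
  have W: "W = vec.span (e ` {..d})" using assms by (auto simp: coord_basis_def)
  assume "\<exists>c. v = (\<Sum>i\<le>d. c i *s e i)"
  then obtain c where v: "v = (\<Sum>i\<le>d. c i *s e i)" by blast
  show "v \<in> W" unfolding W v
    by (intro vec.span_sum vec.span_scale vec.span_base) auto
qed

lemma coord_basis_zero:
  assumes "coord_basis d e W" "(\<Sum>i\<le>d. c i *s e i) = 0" "i \<le> d"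
  shows "c i = 0"
proof -
  have inj: "inj_on e {..d}" and ind: "vec.independent (e ` {..d})"
    using assms by (auto simp: coord_basis_def)
  \<comment> \<open>Independence speaks of coefficients indexed by vectors, so the family
    \<open>c\<close> is carried over along the inverse of \<open>e\<close>.\<close>
  define u where "u = c \<circ> the_inv_into {..d} e"
  have u: "u (e j) = c j" if "j \<le> d" for j
    using that inj by (simp add: u_def the_inv_into_f_f)
  have "(\<Sum>x\<in>e ` {..d}. u x *s x) = (\<Sum>i\<le>d. u (e i) *s e i)"
    using inj by (simp add: sum.reindex)
  also have "\<dots> = 0" using assms(2) u by simp
  finally have "u (e i) = 0"
    using ind assms(3) by (intro vec.independentD[OF ind]) auto
  then show ?thesis using u assms(3) by simp
qed

lemma coord_basis_unique:
  assumes "coord_basis d e W" "(\<Sum>i\<le>d. c i *s e i) = (\<Sum>i\<le>d. c' i *s e i)" "i \<le> d"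
  shows "c i = c' i"
proof -
  have "(\<Sum>i\<le>d. (c i - c' i) *s e i) = 0"
    using assms(2) by (simp add: vec.scale_left_diff_distrib sum_subtractf)
  from coord_basis_zero[OF assms(1) this assms(3)] show ?thesis by simp
qed

lemma coord_basis_subspace: "coord_basis d e W \<Longrightarrow> vec.subspace W"
  by (auto simp: coord_basis_def)

lemma coord_basis_dim: "coord_basis d e W \<Longrightarrow> vec.dim W = d + 1"
  by (auto simp: coord_basis_def vec.dim_eq_card_independent card_image)

lemma coord_basis_exists:
  assumes "proj_subspace d W"
  obtains e where "coord_basis d e W"
proof -
  have W: "vec.subspace W" "vec.dim W = d + 1" using assms by (auto simp: proj_subspace_def)
  obtain B where B: "B \<subseteq> W" "vec.independent B" "W \<subseteq> vec.span B" "card B = vec.dim W"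
    using vec.basis_exists by blast
  have "finite B" using B(4) W(2) by (metis card.infinite Suc_eq_plus1 nat.distinct(1))
  then obtain h where "bij_betw h {0..<card B} B" using ex_bij_betw_nat_finite by blast
  moreover have "{0..<card B} = {..d}" using B(4) W(2) by auto
  ultimately have h: "inj_on h {..d}" "h ` {..d} = B" by (auto simp: bij_betw_def)
  have "vec.span B = W" using B(1,3) W(1) by (simp add: vec.span_subspace)
  then have "coord_basis d h W" unfolding coord_basis_def using h B by simp
  then show ?thesis by (rule that)
qed

lemma sum_atMost_2: "(\<Sum>i\<le>2. f i) = f 0 + f 1 + f (2::nat)" for f :: "nat \<Rightarrow> 'b::comm_monoid_add"
  by (simp add: numeral_2_eq_2)

lemma sum_atMost_3:
  "(\<Sum>i\<le>3. f i) = f 0 + f 1 + f 2 + f (3::nat)" for f :: "nat \<Rightarrow> 'b::comm_monoid_add"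
  by (simp add: numeral_2_eq_2 numeral_3_eq_3)

lemma coord_basis_2_mem:
  assumes "coord_basis 2 e W"
  shows "x *s e 0 + y *s e 1 + z *s e 2 \<in> W"
  unfolding coord_basis_mem_iff[OF assms] sum_atMost_2
  by (rule exI[of _ "\<lambda>i. if i = 0 then x else if i = 1 then y else z"]) simp

lemma coord_basis_2_obtain:
  assumes "coord_basis 2 e W" "v \<in> W"
  obtains x y z where "v = x *s e 0 + y *s e 1 + z *s e 2"
  using assms(2) unfolding coord_basis_mem_iff[OF assms(1)] sum_atMost_2 by blast

lemma coord_basis_2_unique:
  assumes "coord_basis 2 e W"
    and "x *s e 0 + y *s e 1 + z *s e 2 = x' *s e 0 + y' *s e 1 + z' *s e 2"
  shows "x = x'" "y = y'" "z = z'"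
proof -
  let ?c = "\<lambda>i::nat. if i = 0 then x else if i = 1 then y else z"
  let ?c' = "\<lambda>i::nat. if i = 0 then x' else if i = 1 then y' else z'"
  have eq: "(\<Sum>i\<le>2. ?c i *s e i) = (\<Sum>i\<le>2. ?c' i *s e i)"
    unfolding sum_atMost_2 using assms(2) by simp
  show "x = x'" "y = y'" "z = z'"
    using coord_basis_unique[OF assms(1) eq, of 0] coord_basis_unique[OF assms(1) eq, of 1]
      coord_basis_unique[OF assms(1) eq, of 2] by simp_all
qed

lemma curve_vec_2:
  "curve_vec 2 e None = e 2"
  "curve_vec 2 e (Some t) = e 0 + t *s e 1 + t\<^sup>2 *s e 2"
  by (simp_all add: curve_vec_def sum_atMost_2)

lemma curve_vec_mem:
  assumes "coord_basis d e W"
  shows "curve_vec d e \<theta> \<in> W"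
proof -
  have *: "e i \<in> W" if "i \<le> d" for i
    using assms that by (auto simp: coord_basis_def intro: vec.span_base)
  show ?thesis using coord_basis_subspace[OF assms] *
    by (cases \<theta>) (auto simp: curve_vec_def intro!: vec.subspace_sum vec.subspace_scale)
qed

lemma curve_vec_eq_sum: "curve_vec d e \<theta> = (\<Sum>i\<le>d. curve_coord d \<theta> i *s e i)"
  by (cases \<theta>) (simp_all add: curve_vec_def curve_coord_def if_distrib[of "\<lambda>x. x *s _"]
      sum.delta cong: if_cong)

text \<open>Coordinate 0 separates infinity from the finite parameters and forces
  \<open>k = l\<close> between two finite ones; coordinate 1 then compares the parameters.
  Coordinate \<open>d\<close> excludes infinity on the left against a finite parameter on the
  right.\<close>

lemma curve_vec_proportional:
  assumes "coord_basis d e W" "0 < d"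
    and "k *s curve_vec d e \<theta> = l *s curve_vec d e \<theta>'" and "k \<noteq> 0"
  shows "\<theta> = \<theta>'"
proof -
  let ?p = "curve_coord d"
  have "(\<Sum>i\<le>d. (k * ?p \<theta> i) *s e i) = (\<Sum>i\<le>d. (l * ?p \<theta>' i) *s e i)"
    using assms(3) unfolding curve_vec_eq_sum by (simp add: vec.scale_sum_right)
  then have c: "k * ?p \<theta> i = l * ?p \<theta>' i" if "i \<le> d" for i
    using coord_basis_unique[OF assms(1) _ that, of "\<lambda>i. k * ?p \<theta> i" "\<lambda>i. l * ?p \<theta>' i"] by simp
  show ?thesis using c[of 0] c[of 1] c[of d] assms(2,4)
    by (cases \<theta>; cases \<theta>') (auto simp: curve_coord_def split: if_splits)
qed

lemma curve_vec_nonzero: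
  assumes "coord_basis d e W" "0 < d"
  shows "curve_vec d e \<theta> \<noteq> 0"
  \<comment> \<open>With \<open>l = 0\<close> the right-hand side vanishes whatever the second
    parameter is, so a zero curve vector would have parameter \<open>None\<close> and
    \<open>Some 0\<close> at once.\<close>
  using curve_vec_proportional[OF assms, of 1 \<theta> 0 None]
    curve_vec_proportional[OF assms, of 1 \<theta> 0 "Some 0"] by auto

lemma curve_point_inj:
  assumes "coord_basis d e W" "0 < d"
  shows "inj (curve_point d e)"
proof (rule injI)
  fix \<theta> \<theta>' assume "curve_point d e \<theta> = curve_point d e \<theta>'"
  then have "curve_vec d e \<theta> \<in> vec.span {curve_vec d e \<theta>'}"
    unfolding curve_point_eq_span using vec.span_base by blast
  then obtain l where "1 *s curve_vec d e \<theta> = l *s curve_vec d e \<theta>'"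
    by (auto simp: vec.span_singleton)
  from curve_vec_proportional[OF assms this] show "\<theta> = \<theta>'" by simp
qed

lemma proj_points_mem_iff:
  "P \<in> proj_points W \<longleftrightarrow> (\<exists>v. v \<in> W \<and> v \<noteq> 0 \<and> P = vec.span {v})"
  by (auto simp: proj_points_def)

lemma span_singleton_scale:
  fixes v :: "'a::field ^ 'n"
  assumes "k \<noteq> 0"
  shows "vec.span {k *s v} = vec.span {v}"
proof -
  have "v = inverse k *s (k *s v)" using assms by (simp add: vector_smult_assoc)
  then have "v \<in> vec.span {k *s v}" by (metis vec.span_base vec.span_scale singletonI)
  moreover have "k *s v \<in> vec.span {v}" by (simp add: vec.span_base vec.span_scale)
  ultimately show ?thesis by (intro vec.span_eq[THEN iffD2]) simp
qed

section \<open>Conics\<close>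

text \<open>On the conic, x = 0 forces y = 0 and leaves only the point at infinity; otherwise
  dividing by x gives (1, t, t^2) with t = y / x.\<close>

lemma conic_points_eq_range:
  assumes e: "coord_basis 2 e W" and c: "c \<noteq> 0"
    and Q: "\<And>x y z. Q (x *s e 0 + y *s e 1 + z *s e 2) = c * (y\<^sup>2 - x * z)"
  shows "{P \<in> proj_points W. \<forall>v\<in>P. Q v = 0} = range (curve_point 2 e)"
proof (intro set_eqI iffI)
  fix P assume "P \<in> {P \<in> proj_points W. \<forall>v\<in>P. Q v = 0}"
  then obtain v where v: "v \<in> W" "v \<noteq> 0" "P = vec.span {v}" "Q v = 0"
    by (auto simp: proj_points_mem_iff vec.span_base)
  obtain x y z where xyz: "v = x *s e 0 + y *s e 1 + z *s e 2"
    using coord_basis_2_obtain[OF e v(1)] by blast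
  have rel: "y\<^sup>2 = x * z" using v(4) c unfolding xyz Q by simp
  show "P \<in> range (curve_point 2 e)"
  proof (cases "x = 0")
    case True
    then have "v = z *s curve_vec 2 e None" using rel xyz by (simp add: curve_vec_2)
    then have "P = curve_point 2 e None"
      using v(2,3) span_singleton_scale[of z] by (auto simp: curve_point_eq_span)
    then show ?thesis by simp
  next
    case False
    have "x * (y / x)\<^sup>2 = z" using rel False by (simp add: field_simps power2_eq_square)
    then have "v = x *s curve_vec 2 e (Some (y / x))"
      using False xyz by (simp add: curve_vec_2 vec.scale_right_distrib vector_smult_assoc)
    then have "P = curve_point 2 e (Some (y / x))"
      using v(3) False span_singleton_scale[of x] by (auto simp: curve_point_eq_span)
    then show ?thesis by simp
  qed
next
  fix P assume "P \<in> range (curve_point 2 e)"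
  then obtain \<theta> where P: "P = vec.span {curve_vec 2 e \<theta>}" by (auto simp: curve_point_eq_span)
  have "P \<in> proj_points W"
    using P curve_vec_mem[OF e] curve_vec_nonzero[OF e] by (auto simp: proj_points_mem_iff)
  moreover have "Q v = 0" if "v \<in> P" for v
  proof -
    from that P obtain k where k: "v = k *s curve_vec 2 e \<theta>" by (auto simp: vec.span_singleton)
    show ?thesis
    proof (cases \<theta>)
      case None
      then have "v = 0 *s e 0 + 0 *s e 1 + k *s e 2" using k by (simp add: curve_vec_2)
      then have "Q v = c * (0\<^sup>2 - 0 * k)" by (simp only: Q)
      then show ?thesis by simp
    next
      case (Some t)
      then have v: "v = k *s e 0 + (k * t) *s e 1 + (k * t\<^sup>2) *s e 2"
        using k by (simp add: curve_vec_2 vec.scale_right_distrib vector_smult_assoc)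
      show ?thesis unfolding v Q by (simp add: power2_eq_square)
    qed
  qed
  ultimately show "P \<in> {P \<in> proj_points W. \<forall>v\<in>P. Q v = 0}" by simp
qed

lemma nondegenerate_conic_range:
  assumes e: "coord_basis 2 e (W :: ('a::field ^ 'n) set)"
  shows "nondegenerate_conic (range (curve_point 2 e))"
proof -
  let ?v = "\<lambda>(x, y, z). x *s e 0 + y *s e 1 + z *s e 2"
  \<comment> \<open>Coordinates on \<open>W\<close>. Off \<open>W\<close> the choice is arbitrary,
    which is harmless because every condition on the form is restricted to \<open>W\<close>.\<close>
  define co where "co v = (SOME p. v = ?v p)" for v
  have co: "co (x *s e 0 + y *s e 1 + z *s e 2) = (x, y, z)" for x y z
    unfolding co_def
  proof (rule some_equality)
    fix p assume "x *s e 0 + y *s e 1 + z *s e 2 = ?v p"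
    then show "p = (x, y, z)"
      using coord_basis_2_unique[OF e] by (cases p) (simp, metis)
  qed simp
  define Q where "Q v = (case co v of (x, y, z) \<Rightarrow> y\<^sup>2 - x * z)" for v
  have Q: "Q (x *s e 0 + y *s e 1 + z *s e 2) = y\<^sup>2 - x * z" for x y z
    unfolding Q_def co by simp
  have add: "(x *s e 0 + y *s e 1 + z *s e 2) + (x' *s e 0 + y' *s e 1 + z' *s e 2)
      = (x + x') *s e 0 + (y + y') *s e 1 + (z + z') *s e 2" for x y z x' y' z'
    by (simp add: vec.scale_left_distrib)
  have scale: "k *s (x *s e 0 + y *s e 1 + z *s e 2)
      = (k * x) *s e 0 + (k * y) *s e 1 + (k * z) *s e 2" for k x y z
    by (simp add: vec.scale_right_distrib vector_smult_assoc)
  have B: "polar_form Q (x *s e 0 + y *s e 1 + z *s e 2) (x' *s e 0 + y' *s e 1 + z' *s e 2)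
      = 2 * y * y' - x * z' - x' * z" for x y z x' y' z'
    unfolding polar_form_def add Q by (simp add: power2_eq_square algebra_simps)
  have "proj_subspace 2 W"
    using coord_basis_subspace[OF e] coord_basis_dim[OF e] by (simp add: proj_subspace_def)
  moreover have "quadratic_form_on W Q"
    unfolding quadratic_form_on_def
  proof (intro conjI allI ballI)
    fix k v assume "v \<in> W"
    then obtain x y z where v: "v = x *s e 0 + y *s e 1 + z *s e 2"
      by (rule coord_basis_2_obtain[OF e])
    show "Q (k *s v) = k\<^sup>2 * Q v" unfolding v scale Q by (simp add: power2_eq_square algebra_simps)
  next
    fix u v w assume m: "u \<in> W" "v \<in> W" "w \<in> W"
    obtain x y z where u: "u = x *s e 0 + y *s e 1 + z *s e 2"
      using m(1) by (rule coord_basis_2_obtain[OF e])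
    obtain x' y' z' where v: "v = x' *s e 0 + y' *s e 1 + z' *s e 2"
      using m(2) by (rule coord_basis_2_obtain[OF e])
    obtain x'' y'' z'' where w: "w = x'' *s e 0 + y'' *s e 1 + z'' *s e 2"
      using m(3) by (rule coord_basis_2_obtain[OF e])
    show "polar_form Q (u + v) w = polar_form Q u w + polar_form Q v w"
      unfolding u v w add B by (simp add: algebra_simps)
  next
    fix k v w assume m: "v \<in> W" "w \<in> W"
    obtain x y z where v: "v = x *s e 0 + y *s e 1 + z *s e 2"
      using m(1) by (rule coord_basis_2_obtain[OF e])
    obtain x' y' z' where w: "w = x' *s e 0 + y' *s e 1 + z' *s e 2"
      using m(2) by (rule coord_basis_2_obtain[OF e])
    show "polar_form Q (k *s v) w = k * polar_form Q v w"
      unfolding v w scale B by (simp add: algebra_simps)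
  qed
  moreover have "nondegenerate_on W Q"
    unfolding nondegenerate_on_def
  proof (intro ballI impI)
    fix v assume "v \<in> W" and *: "Q v = 0 \<and> (\<forall>w\<in>W. polar_form Q v w = 0)"
    then obtain x y z where v: "v = x *s e 0 + y *s e 1 + z *s e 2"
      using coord_basis_2_obtain[OF e] by metis
    \<comment> \<open>Pairing with \<open>e 0\<close> and \<open>e 2\<close> gives z = 0 and x = 0
      in every characteristic. The polar form contains y only with a factor 2, so y = 0 is taken
      from \<open>Q v = 0\<close>.\<close>
    have "polar_form Q v (1 *s e 0 + 0 *s e 1 + 0 *s e 2) = 0"
      "polar_form Q v (0 *s e 0 + 0 *s e 1 + 1 *s e 2) = 0"
      using * coord_basis_2_mem[OF e] by blast+
    then have "z = 0" "x = 0" unfolding v B by simp_all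
    moreover from this have "y = 0" using * unfolding v Q by simp
    ultimately show "v = 0" using v by simp
  qed
  moreover have "{P \<in> proj_points W. \<forall>v\<in>P. Q v = 0} = range (curve_point 2 e)"
    by (rule conic_points_eq_range[OF e, of 1])
      (simp_all only: Q mult_1_left one_neq_zero not_False_eq_True)
  ultimately show ?thesis unfolding nondegenerate_conic_def by blast
qed

section \<open>Zeros and normal forms of ternary quadratic forms over a finite field\<close>

lemma card_squares:
  "CARD('a::{field,finite}) + 1 \<le> 2 * card (range (\<lambda>x::'a. x\<^sup>2))"
proof -
  let ?R = "range (\<lambda>x::'a. x\<^sup>2)"
  have fib: "card {x::'a. x\<^sup>2 = r} \<le> 2" for r
  proof (cases "\<exists>s. s\<^sup>2 = r")
    case True
    then obtain s where "s\<^sup>2 = r" by blast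
    then have "{x. x\<^sup>2 = r} \<subseteq> {s, - s}" by (auto simp: power2_eq_iff)
    from card_mono[OF _ this] have "card {x. x\<^sup>2 = r} \<le> card {s, - s}" by simp
    also have "\<dots> \<le> 2" by (simp add: card_insert_if)
    finally show ?thesis .
  qed simp
  \<comment> \<open>Zero is split off because it has a single square root; bounding its fibre by 2
    as well would lose the \<open>+ 1\<close>.\<close>
  have U: "(UNIV::'a set) = {0} \<union> (\<Union>r\<in>?R - {0}. {x. x\<^sup>2 = r})" by auto
  have "CARD('a) \<le> card {0::'a} + card (\<Union>r\<in>?R - {0}. {x::'a. x\<^sup>2 = r})"
    by (subst U) (rule card_Un_le)
  also have "card (\<Union>r\<in>?R - {0}. {x::'a. x\<^sup>2 = r}) \<le> (\<Sum>r\<in>?R - {0}. card {x::'a. x\<^sup>2 = r})"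
    by (rule card_UN_le) simp
  also have "\<dots> \<le> (\<Sum>r\<in>?R - {0}. 2)" by (rule sum_mono) (rule fib)
  also have "\<dots> = 2 * (card ?R - 1)" by (simp add: card_Diff_singleton_if image_iff)
  finally have "CARD('a) \<le> 1 + 2 * (card ?R - 1)" by simp
  moreover have "card ?R > 0" by (simp add: card_gt_0_iff)
  ultimately show ?thesis by linarith
qed

text \<open>Pigeonhole: the values a x^2 and the values s - b y^2 each fill more than half of the
  field, so they share an element.\<close>

lemma binary_diagonal_form_universal:
  fixes a b s :: "'a::{field,finite}"
  assumes "a \<noteq> 0" "b \<noteq> 0"
  shows "\<exists>x y. a * x\<^sup>2 + b * y\<^sup>2 = s"
proof -
  let ?R = "range (\<lambda>x::'a. x\<^sup>2)"
  let ?A = "(\<lambda>r. a * r) ` ?R" and ?B = "(\<lambda>r. s - b * r) ` ?R"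
  have "card ?A = card ?R" "card ?B = card ?R"
    using assms by (auto intro!: card_image inj_onI)
  then have "card ?A + card ?B > CARD('a)" using card_squares[where 'a='a] by linarith
  moreover have "card (?A \<union> ?B) \<le> CARD('a)" by (rule card_mono) auto
  moreover have "card ?A + card ?B = card (?A \<union> ?B) + card (?A \<inter> ?B)"
    by (rule card_Un_Int) auto
  ultimately have "card (?A \<inter> ?B) \<noteq> 0" by linarith
  then have "?A \<inter> ?B \<noteq> {}" by auto
  then obtain x y where "a * x\<^sup>2 = s - b * y\<^sup>2" by auto
  then show ?thesis by (intro exI[of _ x] exI[of _ y]) simp
qed

text \<open>Here x = -x, so squaring is injective, and an injective self-map of a finite set is
  surjective.\<close>

lemma char_2_square_root:
  fixes s :: "'a::{field,finite}"
  assumes "(2::'a) = 0"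
  shows "\<exists>x. x\<^sup>2 = s"
proof -
  have neg: "- y = y" for y :: 'a
  proof -
    have "y + y = 2 * y" by (rule mult_2[symmetric])
    also have "\<dots> = 0" unfolding assms by (rule mult_zero_left)
    finally show ?thesis by (rule minus_unique)
  qed
  have "inj (\<lambda>x::'a. x\<^sup>2)"
  proof (rule injI)
    fix x y :: 'a assume "x\<^sup>2 = y\<^sup>2"
    then have "x = y \<or> x = - y" by (rule power2_eq_iff[THEN iffD1])
    then show "x = y" unfolding neg by blast
  qed
  then have "surj (\<lambda>x::'a. x\<^sup>2)" by (rule finite_UNIV_inj_surj[OF finite])
  then obtain x where "s = x\<^sup>2" by (rule surjE)
  then show ?thesis by (intro exI[of _ x]) (rule sym)
qed

text \<open>In characteristic 2 it suffices to remove the terms linear in x and then take a square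
  root. In odd characteristic completing squares reduces the problem to a binary diagonal form,
  which represents every element.\<close>

lemma ternary_form_isotropic:
  fixes a b c f g h :: "'a::{field,finite}"
  shows "\<exists>x y z. (x, y, z) \<noteq> (0, 0, 0) \<and>
    a * x\<^sup>2 + b * y\<^sup>2 + c * z\<^sup>2 + f * y * z + g * x * z + h * x * y = 0"
proof -
  consider (a0) "a = 0" | (even) "a \<noteq> 0" "(2::'a) = 0" | (odd) "a \<noteq> 0" "(2::'a) \<noteq> 0" by blast
  then show ?thesis
  proof cases
    case a0
    then show ?thesis by (intro exI[of _ 1] exI[of _ 0]) simp
  next
    case even
    show ?thesis
    proof (cases "h = 0")
      case True
      obtain x where "x\<^sup>2 = - b / a" using char_2_square_root[OF even(2)] by blast
      then show ?thesis using True even(1)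
        by (intro exI[of _ x] exI[of _ 1] exI[of _ 0]) simp
    next
      case False
      \<comment> \<open>For z = 1 this choice cancels the linear term (g + h y) x.\<close>
      define y where "y = - g / h"
      obtain x where x: "x\<^sup>2 = - (b * y\<^sup>2 + c + f * y) / a"
        using char_2_square_root[OF even(2)] by blast
      have "g * x + h * x * y = 0" using False by (simp add: y_def)
      moreover have "a * x\<^sup>2 = - (b * y\<^sup>2 + c + f * y)" using x even(1) by simp
      ultimately have "a * x\<^sup>2 + b * y\<^sup>2 + c * 1\<^sup>2 + f * y * 1 + g * x * 1 + h * x * y = 0"
        by (simp add: algebra_simps)
      then show ?thesis by (intro exI[of _ x] exI[of _ y] exI[of _ 1]) simp
    qed
  next
    case odd
    \<comment> \<open>Completing the square twice.\<close>
    define b' c' f' where "b' = 4 * a * b - h\<^sup>2" and "c' = 4 * a * c - g\<^sup>2"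
      and "f' = 4 * a * f - 2 * g * h"
    have "\<exists>X y z. (y, z) \<noteq> (0, 0) \<and> X\<^sup>2 + b' * y\<^sup>2 + c' * z\<^sup>2 + f' * y * z = 0"
    proof (cases "b' = 0")
      case True
      then show ?thesis by (intro exI[of _ 0] exI[of _ 1]) simp
    next
      case False
      have "(2::'a) * 2 \<noteq> 0" using odd(2) by (simp only: mult_eq_0_iff) simp
      then have 4: "(4::'a) \<noteq> 0" by simp
      \<comment> \<open>This is the equation with z = 1, multiplied by 4 b' and written in terms of
        Y = 2 b' y + f'.\<close>
      obtain X Y where XY: "4 * b' * X\<^sup>2 + 1 * Y\<^sup>2 = f'\<^sup>2 - 4 * b' * c'"
        using binary_diagonal_form_universal[of "4 * b'" 1] False 4 by force
      define y where "y = (Y - f') / (2 * b')"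
      have y: "2 * b' * y = Y - f'" using False odd(2) by (simp add: y_def)
      have "4 * b' * (X\<^sup>2 + b' * y\<^sup>2 + c' + f' * y)
          = 4 * b' * X\<^sup>2 + (2 * b' * y + f')\<^sup>2 + (4 * b' * c' - f'\<^sup>2)"
        by (simp add: power2_eq_square algebra_simps)
      also have "\<dots> = 0" unfolding y using XY by (simp add: algebra_simps)
      finally have "X\<^sup>2 + b' * y\<^sup>2 + c' + f' * y = 0" using False 4 by simp
      then show ?thesis by (intro exI[of _ X] exI[of _ y] exI[of _ 1]) simp
    qed
    then obtain X y z where yz: "(y, z) \<noteq> (0, 0)"
      and X: "X\<^sup>2 + b' * y\<^sup>2 + c' * z\<^sup>2 + f' * y * z = 0" by blast
    define x where "x = (X - h * y - g * z) / (2 * a)"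
    have x: "2 * a * x + h * y + g * z = X" using odd by (simp add: x_def)
    have "4 * a * (a * x\<^sup>2 + b * y\<^sup>2 + c * z\<^sup>2 + f * y * z + g * x * z + h * x * y)
        = (2 * a * x + h * y + g * z)\<^sup>2 + b' * y\<^sup>2 + c' * z\<^sup>2 + f' * y * z"
      by (simp add: b'_def c'_def f'_def power2_eq_square algebra_simps)
    also have "\<dots> = 0" unfolding x by (rule X)
    finally have "2 * 2 * a * (a * x\<^sup>2 + b * y\<^sup>2 + c * z\<^sup>2 + f * y * z + g * x * z + h * x * y) = 0"
      by simp
    then have "a * x\<^sup>2 + b * y\<^sup>2 + c * z\<^sup>2 + f * y * z + g * x * z + h * x * y = 0"
      using odd by (simp only: mult_eq_0_iff) simp
    then show ?thesis using yz by (intro exI[of _ x] exI[of _ y] exI[of _ z]) auto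
  qed
qed

lemma quadratic_form_isotropic:
  fixes W :: "('a::{field,finite} ^ 'n) set"
  assumes e: "coord_basis 2 e W" and Q: "quadratic_form_on W Q"
  obtains p where "p \<in> W" "p \<noteq> 0" "Q p = 0"
proof -
  let ?B = "polar_form Q"
  have sc: "Q (k *s v) = k\<^sup>2 * Q v" if "v \<in> W" for k v
    using Q that by (simp add: quadratic_form_on_def)
  have Bl: "?B (u + v) w = ?B u w + ?B v w" if "u \<in> W" "v \<in> W" "w \<in> W" for u v w
    using Q that by (simp add: quadratic_form_on_def)
  have Bs: "?B (k *s v) w = k * ?B v w" if "v \<in> W" "w \<in> W" for k v w
    using Q that by (simp add: quadratic_form_on_def)
  have sym: "?B v w = ?B w v" for v w by (simp add: polar_form_def add.commute)
  have add: "Q (v + w) = Q v + Q w + ?B v w" for v w by (simp add: polar_form_def)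
  note sub = coord_basis_subspace[OF e]
  have m: "e 0 \<in> W" "e 1 \<in> W" "e 2 \<in> W"
    using e by (auto simp: coord_basis_def intro: vec.span_base)
  have m': "k *s v \<in> W" if "v \<in> W" for k v using vec.subspace_scale[OF sub that] .
  have Bss: "?B (k *s v) (l *s w) = k * l * ?B v w" if "v \<in> W" "w \<in> W" for k l v w
    using that by (simp add: Bs m' sym[of _ "l *s w"] sym[of w])
  have eq: "Q (x *s e 0 + y *s e 1 + z *s e 2) = Q (e 0) * x\<^sup>2 + Q (e 1) * y\<^sup>2 + Q (e 2) * z\<^sup>2
      + ?B (e 1) (e 2) * y * z + ?B (e 0) (e 2) * x * z + ?B (e 0) (e 1) * x * y" for x y z
    by (simp only: add sc m m' Bl Bss vec.subspace_add[OF sub]) (simp add: algebra_simps)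
  obtain x y z where xyz: "(x, y, z) \<noteq> (0, 0, 0)" "Q (x *s e 0 + y *s e 1 + z *s e 2) = 0"
    unfolding eq using ternary_form_isotropic by metis
  have "x *s e 0 + y *s e 1 + z *s e 2 \<noteq> 0"
    using xyz(1) coord_basis_2_unique[OF e, of x y z 0 0 0] by auto
  then show ?thesis using that coord_basis_2_mem[OF e] xyz(2) by blast
qed

text \<open>An isotropic vector \<open>p\<close> is completed to a hyperbolic pair \<open>p\<close>,
  \<open>v\<close>, and \<open>w\<close> is chosen orthogonal to both. In these vectors the form has
  only a square term in \<open>w\<close> and a product term in \<open>p\<close> and
  \<open>v\<close>, which is y^2 - x z up to scaling.\<close>

lemma nondegenerate_conic_parametrisation:
  fixes D :: "('a::{field,finite} ^ 'n) set set"
  assumes "nondegenerate_conic D"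
  obtains e W where "coord_basis 2 e W" "D = range (curve_point 2 e)"
proof -
  obtain W Q where W: "proj_subspace 2 W" and Q: "quadratic_form_on W Q"
    and nd: "nondegenerate_on W Q" and D: "D = {P \<in> proj_points W. \<forall>v\<in>P. Q v = 0}"
    using assms by (auto simp: nondegenerate_conic_def)
  obtain b where b: "coord_basis 2 b W" using coord_basis_exists[OF W] .
  let ?B = "polar_form Q"
  have sc: "Q (k *s v) = k\<^sup>2 * Q v" if "v \<in> W" for k v
    using Q that by (simp add: quadratic_form_on_def)
  have Bl: "?B (u + v) w = ?B u w + ?B v w" if "u \<in> W" "v \<in> W" "w \<in> W" for u v w
    using Q that by (simp add: quadratic_form_on_def)
  have Bs: "?B (k *s v) w = k * ?B v w" if "v \<in> W" "w \<in> W" for k v w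
    using Q that by (simp add: quadratic_form_on_def)
  have sym: "?B v w = ?B w v" for v w by (simp add: polar_form_def add.commute)
  have add: "Q (v + w) = Q v + Q w + ?B v w" for v w by (simp add: polar_form_def)
  note sub = coord_basis_subspace[OF b]
  have ms: "k *s v \<in> W" if "v \<in> W" for k v using vec.subspace_scale[OF sub that] .
  have ma: "u + v \<in> W" if "u \<in> W" "v \<in> W" for u v using vec.subspace_add[OF sub that] .
  have Bs': "?B w (k *s v) = k * ?B w v" if "v \<in> W" "w \<in> W" for k v w
    using Bs[OF that] sym by metis
  have Bl': "?B w (u + v) = ?B w u + ?B w v" if "u \<in> W" "v \<in> W" "w \<in> W" for u v w
    using Bl[OF that] sym by metis
  have Bself: "?B v v = 2 * Q v" if "v \<in> W" for v
  proof -
    have "Q (v + v) = Q ((1 + 1) *s v)" by (simp only: vec.scale_left_distrib vec.scale_one)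
    also have "\<dots> = (1 + 1)\<^sup>2 * Q v" using sc[OF that] by blast
    finally show ?thesis by (simp add: polar_form_def)
  qed
  obtain p where p: "p \<in> W" "p \<noteq> 0" "Q p = 0" using quadratic_form_isotropic[OF b Q] .
  then obtain v0 where v0: "v0 \<in> W" "?B p v0 \<noteq> 0" using nd by (auto simp: nondegenerate_on_def)
  define v1 where "v1 = inverse (?B p v0) *s v0"
  have v1: "v1 \<in> W" "?B p v1 = 1" using v0 p by (simp_all add: v1_def ms Bs')
  \<comment> \<open>As \<open>p\<close> is isotropic and pairs to 1 with \<open>v1\<close>,
    subtracting \<open>Q v1\<close> times \<open>p\<close> lowers the value of the form by exactly
    \<open>Q v1\<close>.\<close>
  define v where "v = v1 + (- Q v1) *s p"
  have v: "v \<in> W" unfolding v_def using v1 p by (intro ma ms)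
  have pp: "?B p p = 0" using Bself p by simp
  have pv: "?B p v = 1" unfolding v_def using v1 p pp by (simp only: Bl' Bs' ms) simp
  have Qv: "Q v = 0" unfolding v_def add
    using v1 p pp by (simp only: Bl' Bs' ms sc sym[of v1 p]) simp
  have vv: "?B v v = 0" using Bself v Qv by simp
  have "\<not> W \<subseteq> vec.span {p, v}"
  proof
    assume "W \<subseteq> vec.span {p, v}"
    then have "vec.dim W \<le> card {p, v}" by (rule vec.dim_le_card) simp
    also have "\<dots> \<le> 2" by (simp add: card_insert_if)
    finally show False using coord_basis_dim[OF b] by simp
  qed
  then obtain u where u: "u \<in> W" "u \<notin> vec.span {p, v}" by blast
  \<comment> \<open>Orthogonal projection away from the hyperbolic pair: since \<open>p\<close> and
    \<open>v\<close> pair to 1 and are isotropic, the component of \<open>u\<close> along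
    \<open>p\<close> is \<open>?B v u\<close> and the one along \<open>v\<close> is
    \<open>?B p u\<close>.\<close>
  define w where "w = u + ((- ?B v u) *s p + (- ?B p u) *s v)"
  have in_span: "x *s p + y *s v \<in> vec.span {p, v}" for x y
    by (intro vec.span_add vec.span_scale vec.span_base) auto
  have w: "w \<in> W" unfolding w_def using u p v by (intro ma ms)
  have w_notin: "w \<notin> vec.span {p, v}"
    unfolding w_def using u(2) in_span vec.span_add_eq2 by blast
  have pw: "?B p w = 0" unfolding w_def using u p v pp pv
    by (simp only: Bl' Bs' ms ma) simp
  have vw: "?B v w = 0" unfolding w_def using u p v vv pv sym[of v p]
    by (simp only: Bl' Bs' ms ma) simp
  have v_notin: "v \<notin> vec.span {p}"
  proof
    assume "v \<in> vec.span {p}"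
    then obtain k where "v = k *s p" by (auto simp: vec.span_singleton)
    then show False using pv pp p by (simp add: Bs')
  qed
  have ind: "vec.independent {w, v, p}"
    using w_notin v_notin p(2) by (intro vec.independent_insertI)
      (simp_all add: insert_commute vec.independent_empty)
  have ne: "w \<noteq> v" "w \<noteq> p" "v \<noteq> p"
    using w_notin v_notin by (auto simp: vec.span_base)
  have span: "vec.span {w, v, p} = W"
  proof (rule vec.span_subspace[OF _ _ sub])
    show "W \<subseteq> vec.span {w, v, p}"
      by (rule vec.card_ge_dim_independent[OF _ ind]) (use w v p ne coord_basis_dim[OF b] in auto)
  qed (use w v p in auto)
  have wp: "?B w p = 0" and wv: "?B w v = 0" using pw vw sym by metis+
  \<comment> \<open>Otherwise \<open>w\<close> would be orthogonal to \<open>p\<close>, to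
    \<open>v\<close> and, as \<open>?B w w\<close> is twice \<open>Q w\<close>, to itself: a
    singular vector.\<close>
  have Qw: "Q w \<noteq> 0"
  proof
    assume Qw: "Q w = 0"
    have "?B w x = 0" if "x \<in> W" for x
    proof -
      have "x \<in> vec.span {w, v, p}" using that span by simp
      then obtain i j k where x: "x = i *s w + (j *s v + k *s p)"
        by (auto simp: vec.span_insert vec.span_singleton algebra_simps)
      show ?thesis unfolding x using w v p wp wv Bself[OF w] Qw
        by (simp add: Bl' Bs' ms ma)
    qed
    then have "w = 0" using nd w Qw by (auto simp: nondegenerate_on_def)
    then show False using w_notin vec.span_zero by metis
  qed
  \<comment> \<open>The factor \<open>- Q w\<close> on \<open>p\<close> gives the product term the
    coefficient \<open>- Q w\<close>, so that \<open>Q w\<close> can be taken out of the whole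
    form.\<close>
  define e where "e i = (if i = 0 then (- Q w) *s p else if i = 1 then w else v)" for i :: nat
  have "{..2::nat} = {0, 1, 2}" by auto
  then have img: "e ` {..2} = {(- Q w) *s p, w, v}"
    by (simp add: e_def insert_commute)
  have "p = (- inverse (Q w)) *s ((- Q w) *s p)" unfolding vector_smult_assoc using Qw by simp
  then have p_in: "p \<in> vec.span {(- Q w) *s p, w, v}"
    by (metis insertI1 vec.span_base vec.span_scale)
  have W_sub: "W \<subseteq> vec.span (e ` {..2})"
    unfolding img span[symmetric]
    using p_in by (intro vec.span_minimal) (auto intro: vec.span_base)
  have e_sub: "e ` {..2} \<subseteq> W" unfolding img using w v ms[OF p(1)] by blast
  have espan: "vec.span (e ` {..2}) = W" using vec.span_subspace[OF e_sub W_sub sub] .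
  have card3: "card (e ` {..2}) \<ge> 3"
    using vec.dim_le_card[OF W_sub] coord_basis_dim[OF b] by simp
  have "card (e ` {..2}) = card {..2::nat}"
    using card3 card_image_le[of "{..2::nat}" e] by simp
  then have einj: "inj_on e {..2}" by (simp add: eq_card_imp_inj_on)
  have "vec.independent (e ` {..2})"
    by (rule vec.card_le_dim_spanning[OF e_sub W_sub])
      (use card_image_le[of "{..2::nat}" e] coord_basis_dim[OF b] in auto)
  then have e: "coord_basis 2 e W" using einj espan by (simp add: coord_basis_def)
  have "Q (x *s e 0 + y *s e 1 + z *s e 2) = Q w * (y\<^sup>2 - x * z)" for x y z
  proof -
    have e': "e 0 = (- Q w) *s p" "e 1 = w" "e 2 = v" by (simp_all add: e_def)
    show ?thesis unfolding e' vector_smult_assoc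
      using p(1) v w by (simp only: add sc ms ma Bl Bs Bs') (simp add: p Qv pv pw wv algebra_simps)
  qed
  then have "D = range (curve_point 2 e)"
    unfolding D using conic_points_eq_range[OF e Qw] by blast
  then show ?thesis using e that by blast
qed

section \<open>The surface\<close>

lemma poly_eq_0_if_vanishes:
  fixes p :: "'a::{field,finite} poly"
  assumes "\<And>x. poly p x = 0" "degree p < CARD('a)"
  shows "p = 0"
proof (rule ccontr)
  assume "p \<noteq> 0"
  then have "card {x. poly p x = 0} \<le> degree p" by (rule card_poly_roots_bound)
  then show False using assms by simp
qed

text \<open>
  A nonzero remainder \<open>r\<close> of \<open>y 1\<close> modulo \<open>y 0\<close> would satisfy \<open>r ^ 3 = (y 0)\<^sup>2 * z\<close>,
  which is impossible for degree reasons. So \<open>y 1 = k * y 0\<close>, and \<open>y 3 = k ^ 3 * y 0\<close> forces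
  \<open>k\<close> to be constant.
\<close>

lemma twisted_cubic_quadratic_map_constant:
  fixes y :: "nat \<Rightarrow> 'a::field poly"
  assumes deg: "\<And>j. degree (y j) \<le> 2"
    and rel: "(y 1)\<^sup>2 = y 0 * y 2" "y 1 * y 2 = y 0 * y 3" "(y 2)\<^sup>2 = y 1 * y 3"
  shows "\<exists>\<psi> g. degree g \<le> 2 \<and> (\<forall>j\<le>3. y j = smult (curve_coord 3 \<psi> j) g)"
proof (cases "y 0 = 0")
  case True
  then have "y 1 = 0" using rel(1) by simp
  then have "y 2 = 0" using rel(3) by simp
  have "y j = smult (curve_coord 3 None j) (y 3)" if "j \<le> 3" for j
  proof -
    have "j = 0 \<or> j = 1 \<or> j = 2 \<or> j = 3" using that by auto
    then show ?thesis using True \<open>y 1 = 0\<close> \<open>y 2 = 0\<close> by (auto simp: curve_coord_def)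
  qed
  then show ?thesis using deg by blast
next
  case y0: False
  define k r where "k = y 1 div y 0" and "r = y 1 mod y 0"
  have y1: "y 1 = k * y 0 + r" by (simp add: k_def r_def)
  \<comment> \<open>The translation t to t - k maps the twisted cubic to itself; \<open>r\<close>
    and \<open>z\<close> are the second and fourth coordinates of the translated map, whose first is
    still \<open>y 0\<close>.\<close>
  define z where "z = y 3 - 3 * k * y 2 + 3 * k\<^sup>2 * y 1 - k ^ 3 * y 0"
  have cube: "(y 1) ^ 3 = (y 0)\<^sup>2 * y 3"
  proof -
    have "(y 1) ^ 3 = y 1 * (y 1)\<^sup>2" by (simp add: power2_eq_square power3_eq_cube)
    also have "\<dots> = y 0 * (y 1 * y 2)" unfolding rel(1) by (rule mult.left_commute)
    also have "\<dots> = (y 0)\<^sup>2 * y 3" unfolding rel(2) by (simp add: power2_eq_square)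
    finally show ?thesis .
  qed
  have "r ^ 3 = (y 1 - k * y 0) ^ 3" unfolding y1 by simp
  also have "\<dots> = (y 1) ^ 3 - 3 * k * y 0 * (y 1)\<^sup>2 + 3 * k\<^sup>2 * (y 0)\<^sup>2 * y 1 - k ^ 3 * (y 0) ^ 3"
    by (simp add: power2_eq_square power3_eq_cube algebra_simps)
  also have "\<dots> = (y 0)\<^sup>2 * z"
    unfolding cube rel(1) z_def by (simp add: power2_eq_square power3_eq_cube algebra_simps)
  finally have rz: "r ^ 3 = (y 0)\<^sup>2 * z" .
  have "r = 0"
  proof (rule ccontr)
    assume r: "r \<noteq> 0"
    then have z: "z \<noteq> 0" using rz by auto
    have "3 * degree r = 2 * degree (y 0) + degree z"
      using arg_cong[OF rz, of degree] y0 r z by (simp add: degree_mult_eq degree_power_eq)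
    moreover have "degree r < degree (y 0)"
      using degree_mod_less[OF y0, of "y 1"] r by (simp add: r_def)
    \<comment> \<open>Together these would require \<open>y 0\<close> to have degree at least
      3.\<close>
    ultimately show False using deg[of 0] by linarith
  qed
  then have y1: "y 1 = k * y 0" using y1 by simp
  have "y 0 * y 2 = y 0 * (k\<^sup>2 * y 0)"
    unfolding rel(1)[symmetric] y1 by (simp add: power2_eq_square)
  then have y2: "y 2 = k\<^sup>2 * y 0" using y0 by simp
  have "y 0 * y 3 = y 0 * (k ^ 3 * y 0)"
    unfolding rel(2)[symmetric] y1 y2 by (simp add: power2_eq_square power3_eq_cube)
  then have y3: "y 3 = k ^ 3 * y 0" using y0 by simp
  have "degree k = 0"
  proof (cases "k = 0")
    case False
    then have "degree (y 3) = 3 * degree k + degree (y 0)"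
      using y0 by (simp add: y3 degree_mult_eq degree_power_eq)
    then show ?thesis using deg[of 3] by linarith
  qed simp
  then obtain \<kappa> where k: "k = [:\<kappa>:]" by (auto elim: degree_eq_zeroE)
  have "y j = smult (curve_coord 3 (Some \<kappa>) j) (y 0)" if "j \<le> 3" for j
  proof -
    have "j = 0 \<or> j = 1 \<or> j = 2 \<or> j = 3" using that by auto
    then show ?thesis using y1 y2 y3
      by (auto simp: curve_coord_def k power2_eq_square power3_eq_cube mult.assoc)
  qed
  then show ?thesis using deg by blast
qed

section \<open>Generators of the surface and the plane of a conic\<close>

lemma PGL2_inj:
  assumes "\<phi> \<in> PGL2"
  shows "inj \<phi>"
proof -
  obtain a b c d where \<phi>: "\<phi> = moebius a b c d" and det: "a * d - b * c \<noteq> 0"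
    using assms by (auto simp: PGL2_def)
  have cross: False if "(a * s + b) * c = a * (c * s + d)" for s
    using that det by (simp add: algebra_simps)
  have zero: "s = t" if "c * s + d = 0" "c * t + d = 0" for s t
  proof -
    have "c \<noteq> 0" using that det by auto
    moreover have "c * s = c * t" using that by (metis add_right_cancel)
    ultimately show ?thesis by simp
  qed
  have fin: "s = t" if "(a * s + b) * (c * t + d) = (a * t + b) * (c * s + d)" for s t
  proof -
    have "(a * d - b * c) * (s - t) = 0" using that by (simp add: algebra_simps)
    then show ?thesis using det by simp
  qed
  show ?thesis unfolding \<phi>
  proof (rule injI)
    fix \<theta> \<theta>' assume eq: "moebius a b c d \<theta> = moebius a b c d \<theta>'"
    show "\<theta> = \<theta>'"
    proof (cases \<theta>; cases \<theta>')
      fix s assume "\<theta> = None" "\<theta>' = Some s"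
      then show ?thesis using eq cross[of s] det
        by (auto simp: moebius_def frac_eq_eq split: if_splits)
    next
      fix s assume "\<theta> = Some s" "\<theta>' = None"
      then show ?thesis using eq cross[of s] det
        by (auto simp: moebius_def frac_eq_eq split: if_splits)
    next
      fix s t assume "\<theta> = Some s" "\<theta>' = Some t"
      then show ?thesis using eq zero[of s t] fin[of s t]
        by (auto simp: moebius_def frac_eq_eq split: if_splits)
    qed simp
  qed
qed

lemma join_points_span_singletons:
  "P \<in> join_points (vec.span {x}) (vec.span {y}) \<longleftrightarrow>
    (\<exists>k l. k *s x + l *s y \<noteq> 0 \<and> P = vec.span {k *s x + l *s y})"
proof -
  have "vec.span (vec.span {x} \<union> vec.span {y}) = range (\<lambda>(k, l). k *s x + l *s y)"
    unfolding vec.span_Un vec.span_span by (auto simp: vec.span_singleton image_iff)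
  then show ?thesis unfolding join_points_def proj_points_mem_iff by auto
qed

text \<open>Divided differences of (1, t, t^2): two points give \<open>w 1 + (s + t) *s w 2\<close>,
  and two of these give \<open>w 2\<close>. Thus three finite points of a conic span its plane, so
  no line contains them.\<close>

lemma subspace_contains_conic_basis:
  assumes T: "vec.subspace T" and "distinct [t1, t2, t3]"
    and mem: "\<And>t. t \<in> {t1, t2, t3} \<Longrightarrow> curve_vec 2 w (Some t) \<in> T"
  shows "{w 0, w 1, w 2} \<subseteq> T"
proof -
  have cancel: "v \<in> T" if "k *s v \<in> T" "k \<noteq> 0" for k v
    using vec.subspace_scale[OF T that(1), of "inverse k"] that(2) by (simp add: vector_smult_assoc)
  have diff: "w 1 + (s + t) *s w 2 \<in> T" if "s \<in> {t1, t2, t3}" "t \<in> {t1, t2, t3}" "s \<noteq> t" for s t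
  proof (rule cancel[of "s - t"])
    have "curve_vec 2 w (Some s) - curve_vec 2 w (Some t) \<in> T"
      using mem that by (intro vec.subspace_diff[OF T]) auto
    also have "curve_vec 2 w (Some s) - curve_vec 2 w (Some t) = (s - t) *s (w 1 + (s + t) *s w 2)"
      by (simp add: curve_vec_2 vec_eq_iff power2_eq_square algebra_simps)
    finally show "(s - t) *s (w 1 + (s + t) *s w 2) \<in> T" .
  qed (use that in auto)
  have w2: "w 2 \<in> T"
  proof (rule cancel[of "t2 - t3"])
    have "(w 1 + (t1 + t2) *s w 2) - (w 1 + (t1 + t3) *s w 2) \<in> T"
      using assms(2) by (intro vec.subspace_diff[OF T] diff) auto
    also have "(w 1 + (t1 + t2) *s w 2) - (w 1 + (t1 + t3) *s w 2) = (t2 - t3) *s w 2"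
      by (simp add: vec_eq_iff algebra_simps)
    finally show "(t2 - t3) *s w 2 \<in> T" .
  qed (use assms(2) in auto)
  have "(w 1 + (t1 + t2) *s w 2) - (t1 + t2) *s w 2 \<in> T"
    using assms(2) w2 by (intro vec.subspace_diff[OF T] diff vec.subspace_scale[OF T]) auto
  then have w1: "w 1 \<in> T" by simp
  have "curve_vec 2 w (Some t1) - t1 *s w 1 - t1\<^sup>2 *s w 2 \<in> T"
    using mem w1 w2 by (intro vec.subspace_diff[OF T] vec.subspace_scale[OF T]) auto
  then have "w 0 \<in> T" by (simp add: curve_vec_2)
  then show ?thesis using w1 w2 by simp
qed

lemma conic_in_quintic_surface:
  fixes V C :: "('a::{field,finite} ^ 7) set set"
  assumes q: "CARD('a) \<ge> 5"
    and V: "ruled_quintic_surface V C"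
    and D: "nondegenerate_conic D" "D \<subseteq> V"
  shows "D = C"
proof -
  obtain \<alpha> S e f \<phi> where disj: "proj_points \<alpha> \<inter> proj_points S = {}"
    and e: "coord_basis 2 e \<alpha>" and f: "coord_basis 3 f S" and \<phi>: "\<phi> \<in> PGL2"
    and C: "C = range (curve_point 2 e)"
    and V: "V = (\<Union>\<theta>. join_points (curve_point 2 e \<theta>) (curve_point 3 f (\<phi> \<theta>)))"
    using V unfolding ruled_quintic_surface_def by blast
  obtain w W where w: "coord_basis 2 w W" and Dw: "D = range (curve_point 2 w)"
    using nondegenerate_conic_parametrisation[OF D(1)] .
  let ?E = "curve_vec 2 e" and ?F = "\<lambda>\<theta>. curve_vec 3 f (\<phi> \<theta>)" and ?G = "curve_vec 2 w"
  note sub = coord_basis_subspace[OF e] coord_basis_subspace[OF f]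
  have int0: "v = 0" if "v \<in> \<alpha>" "v \<in> S" for v
    using disj that by (auto simp: proj_points_mem_iff disjoint_iff)
  \<comment> \<open>The component in \<open>S\<close> is well defined, which makes sense of the
    projection from \<alpha> onto \<open>S\<close>.\<close>
  have split: "s = s'" if "a + s = a' + s'" "a \<in> \<alpha>" "a' \<in> \<alpha>" "s \<in> S" "s' \<in> S" for a a' s s'
  proof -
    have "a - a' = s' - s" using that(1) by (simp add: algebra_simps)
    then have "s' - s = 0"
      using int0[of "s' - s"] vec.subspace_diff[OF sub(1) that(2,3)]
        vec.subspace_diff[OF sub(2) that(5,4)] by simp
    then show ?thesis by simp
  qed
  have on_gen: "\<exists>\<theta> k l. ?G \<tau> = k *s ?E \<theta> + l *s ?F \<theta>" for \<tau>
  proof -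
    have "curve_point 2 w \<tau> \<in> V" using D(2) Dw by blast
    then obtain \<theta> k l where "vec.span {?G \<tau>} = vec.span {k *s ?E \<theta> + l *s ?F \<theta>}"
      unfolding V curve_point_eq_span UN_iff join_points_span_singletons by blast
    then have "?G \<tau> \<in> vec.span {k *s ?E \<theta> + l *s ?F \<theta>}" using vec.span_base by blast
    then obtain m where "?G \<tau> = m *s (k *s ?E \<theta> + l *s ?F \<theta>)" by (auto simp: vec.span_singleton)
    then have "?G \<tau> = (m * k) *s ?E \<theta> + (m * l) *s ?F \<theta>"
      by (simp add: vec.scale_right_distrib vector_smult_assoc)
    then show ?thesis by blast
  qed
  define T where "T = {a + s | a s. a \<in> \<alpha> \<and> s \<in> S}"
  have T: "vec.subspace T" unfolding T_def by (rule vec.subspace_sums[OF sub])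
  have "?G \<tau> \<in> T" for \<tau>
    using on_gen[of \<tau>] curve_vec_mem[OF e] curve_vec_mem[OF f]
      vec.subspace_scale[OF sub(1)] vec.subspace_scale[OF sub(2)] unfolding T_def by blast
  moreover obtain t1 t2 t3 :: 'a where "distinct [t1, t2, t3]"
  proof -
    have "3 \<le> CARD('a)" using q by simp
    then obtain A :: "'a set" where "card A = 3" by (rule obtain_subset_with_card_n)
    then show ?thesis using that by (auto simp: card_3_iff)
  qed
  ultimately have wT: "{w 0, w 1, w 2} \<subseteq> T" by (intro subspace_contains_conic_basis[OF T]) auto
  have "\<exists>a c. a \<in> \<alpha> \<and> w i = a + (\<Sum>j\<le>3. c j *s f j)" if "i \<in> {0, 1, 2}" for i
  proof -
    have "w i \<in> T" using wT that by auto
    then show ?thesis unfolding T_def using coord_basis_mem_iff[OF f] by auto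
  qed
  then obtain a c where a: "\<And>i. i \<in> {0, 1, 2} \<Longrightarrow> a i \<in> \<alpha>"
    and wac: "\<And>i. i \<in> {0, 1, 2} \<Longrightarrow> w i = a i + (\<Sum>j\<le>3. c i j *s f j)" by metis
  \<comment> \<open>The coordinates, as polynomials in the parameter, of the projection of
    \<open>D\<close> to \<open>S\<close>.\<close>
  define y where "y j = [:c 0 j, c 1 j, c 2 j:]" for j
  have deg: "degree (y j) \<le> 2" for j by (simp add: y_def)
  have G: "?G (Some t) = (a 0 + t *s a 1 + t\<^sup>2 *s a 2) + (\<Sum>j\<le>3. poly (y j) t *s f j)" for t
    unfolding curve_vec_2 using wac[of 0] wac[of 1] wac[of 2]
    by (simp add: y_def sum_atMost_3 vec_eq_iff power2_eq_square algebra_simps)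
  \<comment> \<open>The same projection read off on a generator: it is a multiple, possibly zero, of
    the point where the generator meets the cubic.\<close>
  have coords: "poly (y j) t = l * curve_coord 3 (\<phi> \<theta>) j"
    if eq: "?G (Some t) = k *s ?E \<theta> + l *s ?F \<theta>" and "j \<le> 3" for t k l \<theta> j
  proof -
    have "(\<Sum>j\<le>3. poly (y j) t *s f j) = l *s ?F \<theta>"
    proof (rule split)
      show "(a 0 + t *s a 1 + t\<^sup>2 *s a 2) + (\<Sum>j\<le>3. poly (y j) t *s f j) = k *s ?E \<theta> + l *s ?F \<theta>"
        using eq G by simp
      show "a 0 + t *s a 1 + t\<^sup>2 *s a 2 \<in> \<alpha>"
        using a by (intro vec.subspace_add vec.subspace_scale sub) auto
      show "(\<Sum>j\<le>3. poly (y j) t *s f j) \<in> S"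
        unfolding coord_basis_mem_iff[OF f] by (rule exI[of _ "\<lambda>j. poly (y j) t"]) (rule refl)
    qed (intro vec.subspace_scale sub curve_vec_mem[OF e] curve_vec_mem[OF f])+
    also have "\<dots> = (\<Sum>j\<le>3. (l * curve_coord 3 (\<phi> \<theta>) j) *s f j)"
      unfolding curve_vec_eq_sum by (simp add: vec.scale_sum_right vector_smult_assoc)
    finally show ?thesis by (rule coord_basis_unique[OF f _ that(2)])
  qed
  have cubic: "poly (y 1 * y 1 - y 0 * y 2) t = 0" "poly (y 1 * y 2 - y 0 * y 3) t = 0"
    "poly (y 2 * y 2 - y 1 * y 3) t = 0" for t
  proof -
    obtain \<theta> k l where "?G (Some t) = k *s ?E \<theta> + l *s ?F \<theta>" using on_gen by blast
    from coords[OF this] have y: "poly (y j) t = l * curve_coord 3 (\<phi> \<theta>) j" if "j \<le> 3" for j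
      using that by blast
    show "poly (y 1 * y 1 - y 0 * y 2) t = 0" "poly (y 1 * y 2 - y 0 * y 3) t = 0"
      "poly (y 2 * y 2 - y 1 * y 3) t = 0"
      using y[of 0] y[of 1] y[of 2] y[of 3]
      by (cases "\<phi> \<theta>"; simp add: curve_coord_def power2_eq_square power3_eq_cube)+
  qed
  have deg4: "degree (y i * y j - y k * y l) \<le> 4" for i j k l
    by (intro degree_diff_le order_trans[OF degree_mult_le])
      (use deg[of i] deg[of j] deg[of k] deg[of l] in linarith)+
  have small: "degree (y i * y j - y k * y l) < CARD('a)" for i j k l
    using deg4[of i j k l] q by linarith
  have "\<exists>\<psi> g. degree g \<le> 2 \<and> (\<forall>j\<le>3. y j = smult (curve_coord 3 \<psi> j) g)"
  proof (rule twisted_cubic_quadratic_map_constant[OF deg])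
    show "(y 1)\<^sup>2 = y 0 * y 2" "y 1 * y 2 = y 0 * y 3" "(y 2)\<^sup>2 = y 1 * y 3"
      using poly_eq_0_if_vanishes[OF cubic(1) small] poly_eq_0_if_vanishes[OF cubic(2) small]
        poly_eq_0_if_vanishes[OF cubic(3) small] by (simp_all add: power2_eq_square)
  qed
  then obtain \<psi> g where g: "degree g \<le> 2"
    and yg: "\<And>j. j \<le> 3 \<Longrightarrow> y j = smult (curve_coord 3 \<psi> j) g" by blast
  have "g = 0"
  proof (rule ccontr)
    assume "g \<noteq> 0"
    \<comment> \<open>At most two parameters are roots of \<open>g\<close>, so at least three of the
      five or more field elements are left.\<close>
    then have "card {t. poly g t = 0} \<le> 2" using card_poly_roots_bound g le_trans by blast
    moreover have "card (UNIV - {t. poly g t = 0}) = CARD('a) - card {t. poly g t = 0}"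
      by (rule card_Diff_subset) auto
    ultimately have "3 \<le> card (UNIV - {t. poly g t = 0})" using q by linarith
    then obtain A where A: "A \<subseteq> UNIV - {t. poly g t = 0}" "card A = 3"
      by (rule obtain_subset_with_card_n)
    then obtain s1 s2 s3 where s: "A = {s1, s2, s3}" "distinct [s1, s2, s3]"
      by (auto simp: card_3_iff)
    \<comment> \<open>Where \<open>g\<close> does not vanish, the projected point is the fixed point
      \<psi> of the cubic, and this determines the generator.\<close>
    have gen: "\<exists>\<theta> k l. \<phi> \<theta> = \<psi> \<and> ?G (Some t) = k *s ?E \<theta> + l *s ?F \<theta>" if "t \<in> A" for t
    proof -
      obtain \<theta> k l where G': "?G (Some t) = k *s ?E \<theta> + l *s ?F \<theta>" using on_gen by blast
      have c: "poly g t * curve_coord 3 \<psi> j = l * curve_coord 3 (\<phi> \<theta>) j" if "j \<le> 3" for j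
        using coords[OF G' that] yg[OF that] by (simp add: mult.commute)
      have "poly g t *s curve_vec 3 f \<psi> = l *s curve_vec 3 f (\<phi> \<theta>)"
        unfolding curve_vec_eq_sum using c
        by (simp add: vec.scale_sum_right vector_smult_assoc)
      from curve_vec_proportional[OF f _ this] have "\<psi> = \<phi> \<theta>" using that A by auto
      then show ?thesis using G' by blast
    qed
    have "s1 \<in> A" using s by simp
    then obtain \<theta> where \<theta>: "\<phi> \<theta> = \<psi>" using gen by blast
    define L where "L = vec.span {?E \<theta>, ?F \<theta>}"
    have "?G (Some t) \<in> L" if t: "t \<in> {s1, s2, s3}" for t
    proof -
      obtain \<theta>' k l where *: "\<phi> \<theta>' = \<psi>" "?G (Some t) = k *s ?E \<theta>' + l *s ?F \<theta>'"
        using gen[of t] t unfolding s(1) by blast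
      \<comment> \<open>Injectivity of \<phi> leaves one generator through the cubic point \<psi>,
        so all three conic points lie on the line \<open>L\<close>.\<close>
      have "\<theta>' = \<theta>" using * \<theta> injD[OF PGL2_inj[OF \<phi>]] by simp
      then show ?thesis unfolding *(2) L_def
        by (intro vec.span_add vec.span_scale vec.span_base) auto
    qed
    then have "{w 0, w 1, w 2} \<subseteq> L"
      by (intro subspace_contains_conic_basis[OF _ s(2)]) (auto simp: L_def)
    moreover have "{..2::nat} = {0, 1, 2}" by auto
    ultimately have "w ` {..2} \<subseteq> L" by simp
    then have "W \<subseteq> L"
      using w vec.span_minimal[of "w ` {..2}" L] by (auto simp: coord_basis_def L_def)
    then have "vec.dim W \<le> card {?E \<theta>, ?F \<theta>}" unfolding L_def by (rule vec.dim_le_card) simp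
    also have "\<dots> \<le> 2" by (simp add: card_insert_if)
    finally show False using coord_basis_dim[OF w] by simp
  qed
  then have y0: "y j = 0" if "j \<le> 3" for j using yg[OF that] by simp
  have w\<alpha>: "w i \<in> \<alpha>" if "i \<in> {0, 1, 2}" for i
  proof -
    have "c i j = 0" if "j \<le> 3" for j using y0[OF that] \<open>i \<in> _\<close> by (auto simp: y_def)
    then show ?thesis using wac[OF that] a[OF that] by simp
  qed
  have "?G \<tau> \<in> \<alpha>" for \<tau>
    using w\<alpha> by (cases \<tau>) (auto simp: curve_vec_2 intro!: vec.subspace_add vec.subspace_scale sub)
  have "curve_point 2 w \<tau> \<in> C" for \<tau>
  proof -
    obtain \<theta> k l where *: "?G \<tau> = k *s ?E \<theta> + l *s ?F \<theta>" using on_gen by blast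
    \<comment> \<open>The vector lies in \<alpha>, so its component in \<open>S\<close> is zero and
      only the part on the directrix remains.\<close>
    have "0 = l *s ?F \<theta>"
      by (rule split[of "?G \<tau>" _ "k *s ?E \<theta>"])
        (use * \<open>?G \<tau> \<in> \<alpha>\<close> in \<open>auto intro!: vec.subspace_scale vec.subspace_0 sub
          curve_vec_mem[OF e] curve_vec_mem[OF f]\<close>)
    then have G': "?G \<tau> = k *s ?E \<theta>" using * by simp
    moreover have "?G \<tau> \<noteq> 0" using curve_vec_nonzero[OF w] by simp
    ultimately have "k \<noteq> 0" by auto
    then have "curve_point 2 w \<tau> = curve_point 2 e \<theta>"
      unfolding curve_point_eq_span G' by (rule span_singleton_scale)
    then show ?thesis using C by simp
  qed
  then have "D \<subseteq> C" using Dw by blast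
  \<comment> \<open>Both parametrisations are injective on the same parameter set, so the inclusion
    of finite sets is an equality.\<close>
  moreover have "card D = card C"
    unfolding C Dw using curve_point_inj[OF e] curve_point_inj[OF w] by (simp add: card_image)
  ultimately show ?thesis by (intro card_subset_eq) (simp_all add: C)
qed

theorem theorem2p5:
  fixes V C :: "('a::{field,finite} ^ 7) set set"
  assumes "CARD('a) \<ge> 6"
    and "ruled_quintic_surface V C"
  shows "{D. nondegenerate_conic D \<and> D \<subseteq> V} = {C}"
proof -
  obtain \<alpha> S e f \<phi> where e: "coord_basis 2 e \<alpha>"
    and C: "C = range (curve_point 2 e)" and f: "coord_basis 3 f S"
    and V: "V = (\<Union>\<theta>. join_points (curve_point 2 e \<theta>) (curve_point 3 f (\<phi> \<theta>)))"
    using assms(2) unfolding ruled_quintic_surface_def by blast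
  have "nondegenerate_conic C" unfolding C by (rule nondegenerate_conic_range[OF e])
  moreover have "curve_point 2 e \<theta> \<in> join_points (curve_point 2 e \<theta>) (curve_point 3 f (\<phi> \<theta>))" for \<theta>
    unfolding curve_point_eq_span join_points_span_singletons
    \<comment> \<open>The scalars 1 and 0 select the endpoint of the generator on the
      directrix.\<close>
    by (rule exI[of _ 1], rule exI[of _ 0]) (use curve_vec_nonzero[OF e] in simp)
  then have "C \<subseteq> V" unfolding C V by blast
  moreover have "D = C" if "nondegenerate_conic D" "D \<subseteq> V" for D
    by (rule conic_in_quintic_surface[OF _ assms(2) that]) (use assms(1) in simp)
  ultimately show ?thesis by blast
qed

end
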